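(* (i) A class of matroids has bounded contraction depth if and only if there is an integer bounding the size of every circuit of every matroid in the class. (ii) A class of matroids has bounded deletion depth if and only if there is an integer bounding the size of every cocircuit of every matroid in the class.
   Context: Matroids are finite. Contraction depth $\mathrm{cd}$ and deletion depth $\mathrm{dd}$ of a matroid $M$ are defined recursively: if $E(M)=\emptyset$ both are $0$; if $M$ is disconnected, each is the maximum of the respective depth over the connected components of $M$; if $M$ is connected and $E(M)\neq\emptyset$, $\mathrm{cd}(M)$ is the minimum $k$ such that $\mathrm{cd}(M/e)\le k-1$ for some $e\in E(M)$, and $\mathrm{dd}(M)$ is the minimum $k$ such that $\mathrm{dd}(M\setminus e)\le k-1$ for some $e\in E(M)$. A cocircuit of $M$ is a circuit of the dual matroid $M^*$. *)

theory Defs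
  imports Main
begin

record 'a matroid_system =
  ground :: "'a set"
  indeps :: "'a set set"

locale matroid =
  fixes M :: "'a matroid_system"
  assumes finite_ground: "finite (ground M)"
    and indeps_subset: "I \<in> indeps M \<Longrightarrow> I \<subseteq> ground M"
    and empty_indep: "{} \<in> indeps M"
    and indep_mono: "\<lbrakk>I \<in> indeps M; J \<subseteq> I\<rbrakk> \<Longrightarrow> J \<in> indeps M"
    and augment: "\<lbrakk>I \<in> indeps M; J \<in> indeps M; card I < card J\<rbrakk>
      \<Longrightarrow> \<exists>x \<in> J - I. insert x I \<in> indeps M"

definition matroid_basis :: "'a matroid_system \<Rightarrow> 'a set \<Rightarrow> bool" where
  "matroid_basis M B \<longleftrightarrow> B \<in> indeps M \<and> (\<forall>I \<in> indeps M. B \<subseteq> I \<longrightarrow> I = B)"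

definition matroid_circuit :: "'a matroid_system \<Rightarrow> 'a set \<Rightarrow> bool" where
  "matroid_circuit M C \<longleftrightarrow>
     C \<subseteq> ground M \<and> C \<notin> indeps M \<and> (\<forall>D. D \<subset> C \<longrightarrow> D \<in> indeps M)"

(* The bases of the dual are the complements of the bases of M. *)
definition matroid_dual :: "'a matroid_system \<Rightarrow> 'a matroid_system" where
  "matroid_dual M =
     \<lparr>ground = ground M, indeps = {I. \<exists>B. matroid_basis M B \<and> I \<subseteq> ground M - B}\<rparr>"

definition matroid_cocircuit :: "'a matroid_system \<Rightarrow> 'a set \<Rightarrow> bool" where
  "matroid_cocircuit M C \<longleftrightarrow> matroid_circuit (matroid_dual M) C"

definition matroid_delete :: "'a matroid_system \<Rightarrow> 'a set \<Rightarrow> 'a matroid_system" where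
  "matroid_delete M X =
     \<lparr>ground = ground M - X, indeps = {I \<in> indeps M. I \<subseteq> ground M - X}\<rparr>"

definition matroid_restrict :: "'a matroid_system \<Rightarrow> 'a set \<Rightarrow> 'a matroid_system" where
  "matroid_restrict M X = matroid_delete M (ground M - X)"

definition matroid_contract :: "'a matroid_system \<Rightarrow> 'a set \<Rightarrow> 'a matroid_system" where
  "matroid_contract M X = matroid_dual (matroid_delete (matroid_dual M) X)"

(* For a matroid this is an equivalence relation on the ground set; its classes are
   the connected components. *)
definition circuit_rel :: "'a matroid_system \<Rightarrow> ('a \<times> 'a) set" where
  "circuit_rel M = {(e, f). e \<in> ground M \<and> f \<in> ground M \<and>
     (e = f \<or> (\<exists>C. matroid_circuit M C \<and> e \<in> C \<and> f \<in> C))}"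

definition matroid_components :: "'a matroid_system \<Rightarrow> 'a set set" where
  "matroid_components M = ground M // circuit_rel M"

definition matroid_connected :: "'a matroid_system \<Rightarrow> bool" where
  "matroid_connected M \<longleftrightarrow> ground M = {} \<or> ground M \<in> matroid_components M"

lemma ground_contract [simp]: "ground (matroid_contract M X) = ground M - X"
  by (simp add: matroid_contract_def matroid_dual_def matroid_delete_def)

lemma ground_delete [simp]: "ground (matroid_delete M X) = ground M - X"
  by (simp add: matroid_delete_def)

lemma ground_restrict [simp]: "ground (matroid_restrict M X) = ground M \<inter> X"
  by (auto simp: matroid_restrict_def)

lemma card_ground_component_less:
  assumes "finite (ground M)" "\<not> matroid_connected M" "X \<in> matroid_components M"
  shows "card (ground M \<inter> X) < card (ground M)"
proof -
  have "X \<subseteq> ground M"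
    using assms(3) by (auto simp: matroid_components_def quotient_def circuit_rel_def)
  moreover have "X \<noteq> ground M"
    using assms(2,3) by (auto simp: matroid_connected_def)
  ultimately show ?thesis
    by (intro psubset_card_mono assms(1)) blast
qed

(* The infinite case is a dummy value that only serves termination.
   The condition depth (M/e) <= k - 1 is written with + 1 because subtraction
   on natural numbers truncates. *)
function contraction_depth :: "'a matroid_system \<Rightarrow> nat" where
  "contraction_depth M =
     (if infinite (ground M) \<or> ground M = {} then 0
      else if \<not> matroid_connected M
        then Max ((\<lambda>X. contraction_depth (matroid_restrict M X)) ` matroid_components M)
      else (LEAST k. \<exists>e \<in> ground M. contraction_depth (matroid_contract M {e}) + 1 \<le> k))"
  by pat_completeness auto
termination
  by (relation "measure (\<lambda>M. card (ground M))")
    (auto simp: card_ground_component_less card_gt_0_iff intro!: diff_less)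

function deletion_depth :: "'a matroid_system \<Rightarrow> nat" where
  "deletion_depth M =
     (if infinite (ground M) \<or> ground M = {} then 0
      else if \<not> matroid_connected M
        then Max ((\<lambda>X. deletion_depth (matroid_restrict M X)) ` matroid_components M)
      else (LEAST k. \<exists>e \<in> ground M. deletion_depth (matroid_delete M {e}) + 1 \<le> k))"
  by pat_completeness auto
termination
  by (relation "measure (\<lambda>M. card (ground M))")
    (auto simp: card_ground_component_less card_gt_0_iff intro!: diff_less)

declare contraction_depth.simps [simp del] deletion_depth.simps [simp del]

end

theory Submission
  imports Defs
begin

text \<open>
  Contracting an element turns a circuit into a union of at most two circuits, so a circuit has
  at most \<open>2 ^ k\<close> elements when the contraction depth is \<open>k\<close>. Conversely, contracting a longest
  circuit of a connected matroid strictly lowers the maximum circuit size; doing this at most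
  \<open>n\<close> times, with at most \<open>n\<close> elements each, bounds the depth by \<open>n\<^sup>2 + 1\<close>. The second part is dual to the first:
  a matroid and its dual have the same connected components, so the deletion depth is the
  contraction depth of the dual.
\<close>

section \<open>Circuits and bases\<close>

text \<open>That contracting a longest circuit \<open>C\<close> shortens circuits is the matroid
  form of a fact on 2-connected graphs: two disjoint longest cycles could be rerouted into a longer
  one. The obstacle is that the depth recursion contracts one element at a time and splits into
  components in between, so \<open>C\<close> need not be contracted in one block. The induction
  therefore carries a set \<open>X\<close> still to be contracted and a bound on the circuits of
  \<open>M / X\<close>. This bound survives both contracting an element of \<open>X\<close> and
  restricting to a component, while \<open>card X\<close> pays for the contractions. The summand 1
  in the final bound is for a single element in no circuit, which has depth 1. The dual half needs
  restriction to a component to commute with duality, which fails for restriction to an arbitrary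
  set.\<close>

context matroid
begin

lemma finite_indep: "I \<in> indeps M \<Longrightarrow> finite I"
  using indeps_subset finite_ground finite_subset by blast

lemma circuit_subset_ground: "matroid_circuit M C \<Longrightarrow> C \<subseteq> ground M"
  by (simp add: matroid_circuit_def)

lemma finite_circuit: "matroid_circuit M C \<Longrightarrow> finite C"
  using circuit_subset_ground finite_ground finite_subset by blast

lemma circuit_nonempty: "matroid_circuit M C \<Longrightarrow> C \<noteq> {}"
  using empty_indep by (auto simp: matroid_circuit_def)

lemma circuit_psubset_indep: "\<lbrakk>matroid_circuit M C; D \<subset> C\<rbrakk> \<Longrightarrow> D \<in> indeps M"
  by (simp add: matroid_circuit_def)

lemma circuit_not_indep: "\<lbrakk>matroid_circuit M C; C \<subseteq> A\<rbrakk> \<Longrightarrow> A \<notin> indeps M"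
  using indep_mono by (auto simp: matroid_circuit_def)

lemma circuit_subset_eq:
  "\<lbrakk>matroid_circuit M C; matroid_circuit M D; C \<subseteq> D\<rbrakk> \<Longrightarrow> C = D"
  unfolding matroid_circuit_def by blast

lemma dependent_contains_circuit:
  assumes "A \<subseteq> ground M" "A \<notin> indeps M"
  obtains C where "matroid_circuit M C" "C \<subseteq> A"
proof -
  have "finite A" using assms(1) finite_ground finite_subset by blast
  then have "A \<subseteq> ground M \<Longrightarrow> A \<notin> indeps M \<Longrightarrow> \<exists>C. matroid_circuit M C \<and> C \<subseteq> A"
  proof (induction A rule: finite_psubset_induct)
    case (psubset A)
    show ?case
    proof (cases "matroid_circuit M A")
      case False
      then obtain D where "D \<subset> A" "D \<notin> indeps M"
        using psubset.prems unfolding matroid_circuit_def by blast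
      moreover from this have "D \<subseteq> ground M" using psubset.prems(1) by blast
      ultimately obtain C where "matroid_circuit M C" "C \<subseteq> D" using psubset.IH by blast
      then show ?thesis using \<open>D \<subset> A\<close> by blast
    qed blast
  qed
  then show ?thesis using assms that by blast
qed

lemma indep_iff_no_circuit:
  "I \<in> indeps M \<longleftrightarrow> I \<subseteq> ground M \<and> (\<forall>C. matroid_circuit M C \<longrightarrow> \<not> C \<subseteq> I)"
proof
  assume I: "I \<in> indeps M"
  then show "I \<subseteq> ground M \<and> (\<forall>C. matroid_circuit M C \<longrightarrow> \<not> C \<subseteq> I)"
    using indeps_subset[OF I] circuit_not_indep[of _ I] by blast
next
  assume I: "I \<subseteq> ground M \<and> (\<forall>C. matroid_circuit M C \<longrightarrow> \<not> C \<subseteq> I)"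
  show "I \<in> indeps M"
  proof (rule ccontr)
    assume "I \<notin> indeps M"
    then obtain C where "matroid_circuit M C" "C \<subseteq> I"
      using dependent_contains_circuit I by metis
    then show False using I by simp
  qed
qed

section \<open>Bases relative to a subset of the ground set\<close>

text \<open>The common size of these sets is the rank of \<open>S\<close>. Maximality is phrased by
  one-element extensions, so a basis of \<open>S\<close> remains one of \<open>insert e S\<close> as
  soon as adding \<open>e\<close> to it gives a dependent set.\<close>

definition basis_in :: "'a set \<Rightarrow> 'a set \<Rightarrow> bool" where
  "basis_in S I \<longleftrightarrow> I \<subseteq> S \<and> I \<in> indeps M \<and> (\<forall>x \<in> S - I. insert x I \<notin> indeps M)"

lemma basis_in_card_ge:
  assumes "basis_in S I" "J \<subseteq> S" "J \<in> indeps M"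
  shows "card J \<le> card I"
proof (rule ccontr)
  assume "\<not> ?thesis"
  then obtain x where "x \<in> J - I" "insert x I \<in> indeps M"
    using augment[of I J] assms unfolding basis_in_def by fastforce
  then show False using assms unfolding basis_in_def by blast
qed

lemma basis_in_card_eq: "\<lbrakk>basis_in S I; basis_in S J\<rbrakk> \<Longrightarrow> card I = card J"
  by (meson basis_in_card_ge basis_in_def le_antisym)

lemma extend_to_basis_in:
  assumes "I \<in> indeps M" "I \<subseteq> S"
  obtains B where "basis_in S B" "I \<subseteq> B"
proof -
  let ?P = "\<lambda>J. J \<in> indeps M \<and> I \<subseteq> J \<and> J \<subseteq> S"
  have "\<forall>J. ?P J \<longrightarrow> card J < Suc (card (ground M))"
    using card_mono[OF finite_ground indeps_subset] by (simp add: less_Suc_eq_le)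
  moreover have "?P I" using assms by simp
  ultimately obtain B where B: "?P B" "\<And>J. ?P J \<Longrightarrow> card J \<le> card B"
    using ex_has_greatest_nat[of ?P I card "Suc (card (ground M))"] by blast
  have "basis_in S B"
    unfolding basis_in_def
  proof (intro conjI ballI notI)
    fix x assume x: "x \<in> S - B" "insert x B \<in> indeps M"
    then have "card (insert x B) \<le> card B" using B by blast
    then show False using x B(1) finite_indep by auto
  qed (use B in auto)
  then show ?thesis using that B by blast
qed

lemma matroid_basis_iff: "matroid_basis M B \<longleftrightarrow> basis_in (ground M) B"
proof
  assume "matroid_basis M B"
  then show "basis_in (ground M) B"
    using indeps_subset unfolding matroid_basis_def basis_in_def by blast
next
  assume B: "basis_in (ground M) B"
  have "I = B" if I: "I \<in> indeps M" "B \<subseteq> I" for I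
  proof (rule ccontr)
    assume "I \<noteq> B"
    then obtain x where x: "x \<in> I - B" using I(2) by blast
    have "insert x B \<in> indeps M"
      using indep_mono[OF I(1)] I(2) x by blast
    moreover have "x \<in> ground M" using I(1) x indeps_subset by blast
    ultimately show False using B x unfolding basis_in_def by blast
  qed
  then show "matroid_basis M B" using B unfolding matroid_basis_def basis_in_def by blast
qed

lemma indep_subset_basis:
  assumes "I \<in> indeps M"
  obtains B where "matroid_basis M B" "I \<subseteq> B"
  using assms extend_to_basis_in indeps_subset matroid_basis_iff by metis

lemma basis_subset_ground: "matroid_basis M B \<Longrightarrow> B \<subseteq> ground M"
  by (simp add: matroid_basis_def indeps_subset)

lemma basis_card_eq: "\<lbrakk>matroid_basis M B; matroid_basis M B'\<rbrakk> \<Longrightarrow> card B = card B'"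
  using basis_in_card_eq matroid_basis_iff by blast

text \<open>A maximal independent extension of \<open>I\<close> inside \<open>I \<union> B\<close>
  has at least \<open>card B\<close> elements and is therefore already a basis of
  \<open>M\<close>.\<close>

lemma basis_exchange_indep:
  assumes "I \<in> indeps M" "matroid_basis M B"
  obtains B' where "matroid_basis M B'" "I \<subseteq> B'" "B' \<subseteq> I \<union> B"
proof -
  obtain B' where B': "basis_in (I \<union> B) B'" "I \<subseteq> B'"
    using extend_to_basis_in[OF assms(1), of "I \<union> B"] by blast
  have "card B \<le> card B'"
    using basis_in_card_ge[OF B'(1), of B] assms(2) by (auto simp: matroid_basis_def)
  obtain B'' where B'': "matroid_basis M B''" "B' \<subseteq> B''"
    using B'(1) indep_subset_basis unfolding basis_in_def by blast
  have "card B'' \<le> card B'" using \<open>card B \<le> card B'\<close> basis_card_eq[OF assms(2) B''(1)] by simp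
  then have "B' = B''"
    using B'' finite_indep card_seteq unfolding matroid_basis_def by metis
  then show ?thesis using that B' B'' unfolding basis_in_def by blast
qed

(* With S = (C1 \<union> C2) - {e, f}, S has the same rank as S + e (because of C2) and as
   S + e + f (because of C1), so f is not a coloop of S + f. *)
lemma strong_circuit_elimination:
  assumes C1: "matroid_circuit M C1" and C2: "matroid_circuit M C2"
    and e: "e \<in> C1" "e \<in> C2" and f: "f \<in> C1" "f \<notin> C2"
  obtains C where "matroid_circuit M C" "f \<in> C" "e \<notin> C" "C \<subseteq> C1 \<union> C2"
proof -
  define S where "S = C1 \<union> C2 - {e, f}"
  have indep: "C2 - {e} \<in> indeps M" "C1 - {f} \<in> indeps M"
    using circuit_psubset_indep[OF C2, of "C2 - {e}"] circuit_psubset_indep[OF C1, of "C1 - {f}"]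
      e(2) f(1) by auto
  have S: "S \<subseteq> ground M" using C1 C2 by (auto simp: S_def matroid_circuit_def)
  have sub: "C2 - {e} \<subseteq> S" "C1 - {f} \<subseteq> insert e S" using e f by (auto simp: S_def)
  have dep: "I \<notin> indeps M" if "C1 \<subseteq> I \<or> C2 \<subseteq> I" for I
    using that C1 C2 circuit_not_indep by blast
  obtain I where I: "basis_in S I"
    using extend_to_basis_in[OF empty_indep] by blast
  obtain I2 where I2: "basis_in S I2" "C2 - {e} \<subseteq> I2"
    using extend_to_basis_in[OF indep(1) sub(1)] by blast
  have "insert e I2 \<notin> indeps M" using dep I2(2) by blast
  then have I2': "basis_in (insert e S) I2" using I2(1) unfolding basis_in_def by blast
  obtain I1 where I1: "basis_in (insert e S) I1" "C1 - {f} \<subseteq> I1"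
    using extend_to_basis_in[OF indep(2) sub(2)] by blast
  have "insert f I1 \<notin> indeps M" using dep I1(2) by blast
  then have I1': "basis_in (insert f (insert e S)) I1"
    using I1(1) unfolding basis_in_def by blast
  \<comment> \<open>\<open>I2\<close> is a basis of both \<open>S\<close> and
    \<open>insert e S\<close>, which links the two ranks.\<close>
  have "card I1 = card I"
    using basis_in_card_eq I I1(1) I2(1) I2' by metis
  have "insert f I \<notin> indeps M"
  proof
    assume "insert f I \<in> indeps M"
    moreover have "insert f I \<subseteq> insert f (insert e S)" using I by (auto simp: basis_in_def)
    ultimately have "card (insert f I) \<le> card I"
      using basis_in_card_ge[OF I1'] \<open>card I1 = card I\<close> by metis
    moreover have "f \<notin> I" "finite I" using I finite_indep by (auto simp: basis_in_def S_def)
    ultimately show False by simp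
  qed
  moreover have "insert f I \<subseteq> ground M"
    using I S f(1) circuit_subset_ground[OF C1] by (auto simp: basis_in_def)
  ultimately obtain C where C: "matroid_circuit M C" "C \<subseteq> insert f I"
    using dependent_contains_circuit by blast
  have "I \<in> indeps M" using I by (simp add: basis_in_def)
  then have "f \<in> C" using C circuit_not_indep[OF C(1), of I] by blast
  moreover have "I \<subseteq> S" using I by (simp add: basis_in_def)
  moreover have "e \<noteq> f" using e f by blast
  ultimately show ?thesis using that C f unfolding S_def by blast
qed

section \<open>Connected components\<close>

text \<open>This is the transitivity of \<open>circuit_rel\<close>. In a counterexample with
  smallest union, eliminating a common element \<open>f\<close> in both orders gives
  \<open>C3\<close> through \<open>e\<close> and \<open>C4\<close> through \<open>g\<close>.
  Minimality for \<open>C3\<close> and \<open>C2\<close> forces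
  \<open>C1 - C2 \<subseteq> C3\<close>; as \<open>C4\<close> leaves \<open>C2\<close>, it meets
  \<open>C3\<close>, and the pair \<open>C3\<close>, \<open>C4\<close> has a smaller union because
  both avoid \<open>f\<close>.\<close>

lemma circuits_share_circuit:
  assumes "matroid_circuit M C1" "matroid_circuit M C2" "e \<in> C1" "g \<in> C2" "C1 \<inter> C2 \<noteq> {}"
  shows "\<exists>C. matroid_circuit M C \<and> e \<in> C \<and> g \<in> C"
  using assms
proof (induction "card (C1 \<union> C2)" arbitrary: C1 C2 rule: less_induct)
  case less
  note C1 = less.prems(1) and C2 = less.prems(2)
  show ?case
  proof (rule ccontr)
    assume none: "\<not> ?case"
    then have eg: "e \<notin> C2" "g \<notin> C1" using less.prems by blast+
    obtain f where f: "f \<in> C1" "f \<in> C2" using less.prems by blast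
    have fin: "finite (C1 \<union> C2)" using C1 C2 finite_circuit by blast
    have min: False
      if "matroid_circuit M A" "matroid_circuit M B" "e \<in> A" "g \<in> B" "A \<inter> B \<noteq> {}"
        "A \<union> B \<subset> C1 \<union> C2" for A B
      using less.hyps[OF psubset_card_mono[OF fin that(6)] that(1-5)] none by simp
    obtain C3 where C3: "matroid_circuit M C3" "e \<in> C3" "f \<notin> C3" "C3 \<subseteq> C1 \<union> C2"
      using strong_circuit_elimination[OF C1 C2 f less.prems(3) eg(1)] .
    obtain C4 where C4: "matroid_circuit M C4" "g \<in> C4" "f \<notin> C4" "C4 \<subseteq> C1 \<union> C2"
      using strong_circuit_elimination[OF C2 C1 f(2,1) less.prems(4) eg(2)] unfolding Un_commute[of C2] .
    have "\<not> C3 \<subseteq> C1" using circuit_subset_eq[OF C3(1) C1] C3 f by blast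
    then have "C3 \<inter> C2 \<noteq> {}" using C3(4) by blast
    then have "C1 - C2 \<subseteq> C3" using min[OF C3(1) C2 C3(2) less.prems(4)] C3(4) by blast
    moreover have "\<not> C4 \<subseteq> C2" using circuit_subset_eq[OF C4(1) C2] C4 f by blast
    ultimately have "C3 \<inter> C4 \<noteq> {}" using C4(4) by blast
    then show False using min[OF C3(1) C4(1) C3(2) C4(2)] C3 C4 f by blast
  qed
qed

lemma equiv_circuit_rel: "equiv (ground M) (circuit_rel M)"
proof (rule equivI)
  show "circuit_rel M \<subseteq> ground M \<times> ground M" by (auto simp: circuit_rel_def)
  show "refl_on (ground M) (circuit_rel M)" by (auto simp: circuit_rel_def refl_on_def)
  show "sym (circuit_rel M)" unfolding circuit_rel_def sym_def by blast
  show "trans (circuit_rel M)"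
  proof (rule transI)
    fix x y z assume xy: "(x, y) \<in> circuit_rel M" and yz: "(y, z) \<in> circuit_rel M"
    show "(x, z) \<in> circuit_rel M"
    proof (cases "x = y \<or> y = z")
      case False
      then obtain C1 C2 where "matroid_circuit M C1" "x \<in> C1" "y \<in> C1"
        "matroid_circuit M C2" "y \<in> C2" "z \<in> C2"
        using xy yz unfolding circuit_rel_def by blast
      then show ?thesis
        using xy yz circuits_share_circuit[of C1 C2 x z] unfolding circuit_rel_def by blast
    qed (use xy yz in blast)
  qed
qed

lemma component_subset_ground: "X \<in> matroid_components M \<Longrightarrow> X \<subseteq> ground M"
  unfolding matroid_components_def quotient_def circuit_rel_def by blast

lemma finite_components: "finite (matroid_components M)"
  using component_subset_ground finite_ground by (metis Pow_iff finite_Pow_iff finite_subset subsetI)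

lemma element_in_component:
  assumes "e \<in> ground M"
  obtains X where "X \<in> matroid_components M" "e \<in> X"
  using assms Union_quotient[OF equiv_circuit_rel] unfolding matroid_components_def by blast

lemma components_nonempty: "ground M \<noteq> {} \<Longrightarrow> matroid_components M \<noteq> {}"
  using element_in_component by (metis all_not_in_conv)

lemma circuit_subset_component:
  assumes "X \<in> matroid_components M" "matroid_circuit M C" "C \<inter> X \<noteq> {}"
  shows "C \<subseteq> X"
proof
  fix f assume "f \<in> C"
  obtain e where e: "e \<in> C" "e \<in> X" using assms by blast
  then have "(e, f) \<in> circuit_rel M"
    using \<open>f \<in> C\<close> assms(2) circuit_subset_ground unfolding circuit_rel_def by blast
  then show "f \<in> X"
    using in_quotient_imp_closed[OF equiv_circuit_rel _ e(2)] assms(1)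
    unfolding matroid_components_def by simp
qed

lemma component_related:
  "\<lbrakk>X \<in> matroid_components M; e \<in> X; f \<in> X\<rbrakk> \<Longrightarrow> (e, f) \<in> circuit_rel M"
  using in_quotient_imp_in_rel[OF equiv_circuit_rel] unfolding matroid_components_def by simp

lemma connected_circuit:
  assumes "matroid_connected M" "e \<in> ground M" "f \<in> ground M" "e \<noteq> f"
  obtains C where "matroid_circuit M C" "e \<in> C" "f \<in> C"
  using assms component_related[of "ground M" e f]
  unfolding matroid_connected_def circuit_rel_def by blast

section \<open>Minors\<close>

lemma matroid_delete: "matroid (matroid_delete M X)"
proof
  fix I J assume "I \<in> indeps (matroid_delete M X)" "J \<in> indeps (matroid_delete M X)" "card I < card J"
  then show "\<exists>x \<in> J - I. insert x I \<in> indeps (matroid_delete M X)"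
    using augment[of I J] by (auto simp: matroid_delete_def)
qed (use finite_ground empty_indep indep_mono in \<open>auto simp: matroid_delete_def\<close>)

lemma matroid_restrict: "matroid (matroid_restrict M X)"
  by (simp add: matroid_restrict_def matroid_delete)

lemma circuit_delete_iff:
  "matroid_circuit (matroid_delete M X) C \<longleftrightarrow> matroid_circuit M C \<and> C \<inter> X = {}"
  using circuit_subset_ground by (auto simp: matroid_circuit_def matroid_delete_def)

lemma circuit_restrict_iff:
  "matroid_circuit (matroid_restrict M X) C \<longleftrightarrow> matroid_circuit M C \<and> C \<subseteq> X"
  unfolding matroid_restrict_def circuit_delete_iff using circuit_subset_ground by blast

section \<open>Dual matroids\<close>

lemma matroid_basis_dual_iff:
  "matroid_basis (matroid_dual M) A \<longleftrightarrow> (\<exists>B. matroid_basis M B \<and> A = ground M - B)"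
proof
  assume A: "matroid_basis (matroid_dual M) A"
  then obtain B where B: "matroid_basis M B" "A \<subseteq> ground M - B"
    unfolding matroid_basis_def[of "matroid_dual M"] by (auto simp: matroid_dual_def)
  have "ground M - B \<in> indeps (matroid_dual M)" using B(1) by (auto simp: matroid_dual_def)
  then show "\<exists>B. matroid_basis M B \<and> A = ground M - B"
    using A B unfolding matroid_basis_def[of "matroid_dual M"] by blast
next
  assume "\<exists>B. matroid_basis M B \<and> A = ground M - B"
  then obtain B where B: "matroid_basis M B" "A = ground M - B" by blast
  have "I = A" if I: "I \<in> indeps (matroid_dual M)" "A \<subseteq> I" for I
  proof -
    obtain B' where B': "matroid_basis M B'" "I \<subseteq> ground M - B'"
      using I(1) by (auto simp: matroid_dual_def)
    then have "B' \<subseteq> B" using I(2) B(2) basis_subset_ground[of B'] by blast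
    then have "B' = B" using B(1) B'(1) unfolding matroid_basis_def by blast
    then show ?thesis using B' B I by blast
  qed
  moreover have "A \<in> indeps (matroid_dual M)" using B by (auto simp: matroid_dual_def)
  ultimately show "matroid_basis (matroid_dual M) A" unfolding matroid_basis_def by blast
qed

lemma ground_dual: "ground (matroid_dual M) = ground M"
  by (simp add: matroid_dual_def)

lemma dual_dual: "matroid_dual (matroid_dual M) = M"
proof -
  have "(\<exists>A. matroid_basis (matroid_dual M) A \<and> I \<subseteq> ground M - A) \<longleftrightarrow> I \<in> indeps M" for I
  proof
    assume "\<exists>A. matroid_basis (matroid_dual M) A \<and> I \<subseteq> ground M - A"
    then obtain B where "matroid_basis M B" "I \<subseteq> B"
      unfolding matroid_basis_dual_iff by blast
    then show "I \<in> indeps M" using indep_mono unfolding matroid_basis_def by blast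
  next
    assume "I \<in> indeps M"
    then obtain B where "matroid_basis M B" "I \<subseteq> B" using indep_subset_basis by blast
    then show "\<exists>A. matroid_basis (matroid_dual M) A \<and> I \<subseteq> ground M - A"
      unfolding matroid_basis_dual_iff using basis_subset_ground by blast
  qed
  then show ?thesis
    unfolding matroid_dual_def[of "matroid_dual M"] ground_dual by simp
qed

text \<open>For augmentation, \<open>B' - I\<close> is completed from \<open>B\<close> to a basis
  \<open>B''\<close>, which still avoids \<open>I\<close>. If \<open>B''\<close> contained all of
  \<open>J - I\<close>, counting would give
  \<open>card (J - I) \<le> card (B' \<inter> I) \<le> card (I - J)\<close>, against
  \<open>card I < card J\<close>. So some element of \<open>J - I\<close> lies outside
  \<open>B''\<close>.\<close>

lemma matroid_dual: "matroid (matroid_dual M)"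
proof
  show "{} \<in> indeps (matroid_dual M)"
    using indep_subset_basis[OF empty_indep] by (auto simp: matroid_dual_def)
next
  fix I J assume I: "I \<in> indeps (matroid_dual M)" and J: "J \<in> indeps (matroid_dual M)"
    and less: "card I < card J"
  obtain B where B: "matroid_basis M B" "I \<subseteq> ground M - B" using I by (auto simp: matroid_dual_def)
  obtain B' where B': "matroid_basis M B'" "J \<subseteq> ground M - B'" using J by (auto simp: matroid_dual_def)
  have fin: "finite I" "finite J" "finite B'"
    using B B' basis_subset_ground finite_ground by (meson Diff_subset finite_subset)+
  have "B' - I \<in> indeps M" using B'(1) indep_mono[of B'] by (simp add: matroid_basis_def)
  then obtain B'' where B'': "matroid_basis M B''" "B' - I \<subseteq> B''" "B'' \<subseteq> (B' - I) \<union> B"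
    using basis_exchange_indep B(1) by blast
  have "\<not> J - I \<subseteq> B''"
  proof
    assume "J - I \<subseteq> B''"
    have "card (J - I) + card (B' - I) = card ((J - I) \<union> (B' - I))"
      using fin B'(2) by (subst card_Un_disjoint) auto
    also have "\<dots> \<le> card B''"
      using \<open>J - I \<subseteq> B''\<close> B''(1,2) finite_indep
      by (intro card_mono) (auto simp: matroid_basis_def)
    also have "\<dots> = card B'" using basis_card_eq B''(1) B'(1) by blast
    also have "\<dots> = card (B' - I) + card (B' \<inter> I)"
      using fin by (metis add.commute card_Int_Diff)
    finally have "card (J - I) \<le> card (B' \<inter> I)" by simp
    also have "\<dots> \<le> card (I - J)" using fin B'(2) by (intro card_mono) auto
    finally show False
      using less fin card_Int_Diff[of I J] card_Int_Diff[of J I] by (simp add: Int_commute)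
  qed
  then obtain x where "x \<in> J - I" "x \<notin> B''" by blast
  then have "insert x I \<subseteq> ground M - B''" using B B' B'' by blast
  then show "\<exists>x \<in> J - I. insert x I \<in> indeps (matroid_dual M)"
    using \<open>x \<in> J - I\<close> B''(1) by (auto simp: matroid_dual_def)
qed (use finite_ground in \<open>auto simp: matroid_dual_def\<close>)

lemma indep_dual_iff:
  "I \<in> indeps (matroid_dual M) \<longleftrightarrow> (\<exists>B. matroid_basis M B \<and> I \<subseteq> ground M - B)"
  by (simp add: matroid_dual_def)

section \<open>Contraction of a single element\<close>

lemma contract_eqI:
  assumes "matroid N" "matroid_dual N = matroid_delete (matroid_dual M) X"
  shows "matroid_contract M X = N"
  unfolding matroid_contract_def assms(2)[symmetric] using matroid.dual_dual[OF assms(1)] .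

text \<open>A loop lies in no independent set, so deleting it leaves the bases unchanged and only
  shrinks the ground set.\<close>

lemma contract_loop:
  assumes "{e} \<notin> indeps M"
  shows "matroid_contract M {e} = matroid_delete M {e}"
proof (rule contract_eqI)
  have e: "e \<notin> I" if "I \<in> indeps M" for I
    using that indep_mono[of I "{e}"] assms by blast
  have "indeps (matroid_delete M {e}) = indeps M"
    using e indeps_subset by (auto simp: matroid_delete_def)
  then have basis: "matroid_basis (matroid_delete M {e}) = matroid_basis M"
    by (simp add: matroid_basis_def fun_eq_iff)
  then show "matroid_dual (matroid_delete M {e}) = matroid_delete (matroid_dual M) {e}"
    by (auto simp: matroid_dual_def matroid_delete_def basis)
qed (rule matroid_delete)

text \<open>\<open>N\<close> is the usual contraction by a nonloop. Its bases are the bases of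
  \<open>M\<close> through \<open>e\<close> with \<open>e\<close> removed, and comparing complements
  of bases identifies its dual.\<close>

lemma contract_nonloop:
  assumes "{e} \<in> indeps M"
  defines "N \<equiv> \<lparr>ground = ground M - {e}, indeps = {I. e \<notin> I \<and> insert e I \<in> indeps M}\<rparr>"
  shows "matroid N" and "matroid_contract M {e} = N"
proof -
  show N: "matroid N"
  proof
    fix I J assume IJ: "I \<in> indeps N" "J \<in> indeps N" "card I < card J"
    then have "finite I" "finite J"
      using finite_indep[of "insert e I"] finite_indep[of "insert e J"] by (auto simp: N_def)
    then have "card (insert e I) < card (insert e J)" using IJ by (simp add: N_def)
    then obtain x where "x \<in> insert e J - insert e I" "insert x (insert e I) \<in> indeps M"
      using augment[of "insert e I" "insert e J"] IJ by (auto simp: N_def)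
    then show "\<exists>x \<in> J - I. insert x I \<in> indeps N"
      using IJ by (auto simp: N_def insert_commute)
  next
    fix I J assume "I \<in> indeps N" "J \<subseteq> I"
    then show "J \<in> indeps N" using indep_mono[of "insert e I" "insert e J"] by (auto simp: N_def)
  qed (use finite_ground assms(1) indeps_subset in \<open>auto simp: N_def\<close>)
  have basis: "matroid_basis N A \<longleftrightarrow> e \<notin> A \<and> matroid_basis M (insert e A)" for A
  proof
    assume A: "matroid_basis N A"
    then have eA: "e \<notin> A" "insert e A \<in> indeps M" by (auto simp: matroid_basis_def N_def)
    have "I = insert e A" if I: "I \<in> indeps M" "insert e A \<subseteq> I" for I
    proof -
      have "I - {e} \<in> indeps N" "A \<subseteq> I - {e}"
        using I eA by (auto simp: N_def insert_absorb)
      then have "I - {e} = A" using A unfolding matroid_basis_def by blast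
      then show ?thesis using I by blast
    qed
    then show "e \<notin> A \<and> matroid_basis M (insert e A)"
      using eA unfolding matroid_basis_def by blast
  next
    assume A: "e \<notin> A \<and> matroid_basis M (insert e A)"
    have "I = A" if I: "I \<in> indeps N" "A \<subseteq> I" for I
    proof -
      have "insert e I = insert e A" using I A unfolding matroid_basis_def N_def by auto
      then show ?thesis using I A unfolding N_def by auto
    qed
    then show "matroid_basis N A" using A unfolding matroid_basis_def N_def by auto
  qed
  have "I \<in> indeps (matroid_dual N) \<longleftrightarrow> I \<in> indeps (matroid_delete (matroid_dual M) {e})" for I
  proof
    assume "I \<in> indeps (matroid_dual N)"
    then obtain A where A: "matroid_basis N A" "I \<subseteq> ground M - {e} - A"
      by (auto simp: matroid_dual_def N_def)
    then show "I \<in> indeps (matroid_delete (matroid_dual M) {e})"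
      using basis[of A] unfolding matroid_delete_def matroid_dual_def by auto
  next
    assume I: "I \<in> indeps (matroid_delete (matroid_dual M) {e})"
    then obtain B where B: "matroid_basis M B" "I \<subseteq> ground M - B" "e \<notin> I"
      by (auto simp: matroid_dual_def matroid_delete_def)
    \<comment> \<open>The witness \<open>B\<close> may miss \<open>e\<close>. Exchanging
      \<open>e\<close> into it only adds \<open>e\<close>, which is not in \<open>I\<close>, so the
      new basis still avoids \<open>I\<close>.\<close>
    then obtain B' where B': "matroid_basis M B'" "e \<in> B'" "B' \<subseteq> insert e B"
      using basis_exchange_indep[OF assms(1) B(1)] by auto
    have "matroid_basis N (B' - {e})" using basis B' by (simp add: insert_absorb)
    moreover have "I \<subseteq> ground N - (B' - {e})" using B B' by (auto simp: N_def)
    ultimately show "I \<in> indeps (matroid_dual N)" by (auto simp: matroid_dual_def)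
  qed
  moreover have "ground (matroid_dual N) = ground (matroid_delete (matroid_dual M) {e})"
    by (simp add: matroid_dual_def N_def)
  ultimately have "matroid_dual N = matroid_delete (matroid_dual M) {e}"
    by (intro matroid_system.equality) auto
  then show "matroid_contract M {e} = N" using contract_eqI N by blast
qed

lemma matroid_contract: "matroid (matroid_contract M {e})"
  using contract_loop[of e] contract_nonloop[of e] matroid_delete[of "{e}"]
  by (cases "{e} \<in> indeps M") simp_all

text \<open>The exception \<open>Z \<subseteq> {e}\<close> lets one formula serve both cases: it
  never occurs for a nonloop, and a loop is a circuit that shares its element with no other
  circuit.\<close>

lemma indep_contract_iff:
  assumes "e \<in> ground M"
  shows "I \<in> indeps (matroid_contract M {e}) \<longleftrightarrow>
    I \<subseteq> ground M - {e} \<and> (\<forall>Z. matroid_circuit M Z \<and> Z \<subseteq> insert e I \<longrightarrow> Z \<subseteq> {e})"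
proof (cases "{e} \<in> indeps M")
  case True
  then have "\<not> Z \<subseteq> {e}" if "matroid_circuit M Z" for Z
    using circuit_not_indep[OF that] by blast
  then show ?thesis
    unfolding contract_nonloop(2)[OF True]
    using indep_iff_no_circuit[of "insert e I"] assms by auto
next
  case False
  then have e: "matroid_circuit M {e}"
    using assms empty_indep by (auto simp: matroid_circuit_def subset_singleton_iff psubset_eq)
  then have loop: "Z = {e}" if "matroid_circuit M Z" "e \<in> Z" for Z
    using that circuit_subset_eq[OF e that(1)] by simp
  have "\<not> Z \<subseteq> I \<longleftrightarrow> (Z \<subseteq> insert e I \<longrightarrow> Z \<subseteq> {e})" if "matroid_circuit M Z" "e \<notin> I" for Z
    using that loop[OF that(1)] circuit_nonempty[OF that(1)] by (cases "e \<in> Z") auto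
  then have "(\<forall>Z. matroid_circuit M Z \<longrightarrow> \<not> Z \<subseteq> I) \<longleftrightarrow>
      (\<forall>Z. matroid_circuit M Z \<and> Z \<subseteq> insert e I \<longrightarrow> Z \<subseteq> {e})" if "e \<notin> I"
    using that by metis
  moreover have "I \<in> indeps (matroid_contract M {e}) \<longleftrightarrow> I \<in> indeps M \<and> I \<subseteq> ground M - {e}"
    by (simp add: contract_loop[OF False] matroid_delete_def)
  ultimately show ?thesis
    using indep_iff_no_circuit[of I] by (cases "I \<subseteq> ground M - {e}") auto
qed

lemma circuit_contract:
  assumes "matroid_circuit M Z" "e \<in> Z" "Z \<noteq> {e}"
  shows "matroid_circuit (matroid_contract M {e}) (Z - {e})"
proof -
  have e: "e \<in> ground M" using assms circuit_subset_ground by blast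
  have "Z \<subseteq> insert e (Z - {e})" "\<not> Z \<subseteq> {e}" using assms(2,3) by auto
  then have "Z - {e} \<notin> indeps (matroid_contract M {e})"
    using assms(1) unfolding indep_contract_iff[OF e] by metis
  moreover have "D \<in> indeps (matroid_contract M {e})" if D: "D \<subset> Z - {e}" for D
  proof -
    have "\<not> Y \<subseteq> insert e D" if "matroid_circuit M Y" for Y
      using circuit_subset_eq[OF that assms(1)] D assms(2) by blast
    then show ?thesis
      using D circuit_subset_ground[OF assms(1)] unfolding indep_contract_iff[OF e] by blast
  qed
  ultimately show ?thesis
    using circuit_subset_ground[OF assms(1)] by (auto simp: matroid_circuit_def)
qed

lemma circuit_of_contract:
  assumes "matroid_circuit (matroid_contract M {e}) V" "e \<in> ground M"
  obtains Z where "matroid_circuit M Z" "V = Z - {e}"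
proof -
  have V: "V \<subseteq> ground M - {e}" "V \<notin> indeps (matroid_contract M {e})"
    "\<And>D. D \<subset> V \<Longrightarrow> D \<in> indeps (matroid_contract M {e})"
    using assms(1) by (auto simp: matroid_circuit_def)
  then obtain Z where Z: "matroid_circuit M Z" "Z \<subseteq> insert e V" "\<not> Z \<subseteq> {e}"
    unfolding indep_contract_iff[OF assms(2)] by blast
  have "Z \<subseteq> insert e (Z - {e})" by blast
  then have "Z - {e} \<notin> indeps (matroid_contract M {e})"
    using Z unfolding indep_contract_iff[OF assms(2)] by metis
  then have "\<not> Z - {e} \<subset> V" using V(3) by blast
  moreover have "Z - {e} \<subseteq> V" using Z(2) by blast
  ultimately show ?thesis using Z(1) that by blast
qed

text \<open>If \<open>e\<close> is in \<open>W\<close>, or \<open>W\<close> stays a circuit, one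
  circuit is enough. Otherwise \<open>W\<close> properly contains a circuit
  \<open>D = Z - {e}\<close> of the contraction. Eliminating some \<open>f\<close> in
  \<open>D\<close> from \<open>Z\<close> and \<open>W\<close> while keeping \<open>e\<close> gives
  \<open>Z'\<close>; eliminating \<open>e\<close> from \<open>Z\<close> and \<open>Z'\<close> then
  gives a circuit inside \<open>W\<close>, hence \<open>W\<close> itself. So \<open>Z\<close> and
  \<open>Z'\<close> together cover \<open>W\<close>.\<close>

lemma circuit_minus_cover:
  assumes W: "matroid_circuit M W" and e: "e \<in> ground M" and ne: "W \<noteq> {e}"
  obtains D D' where "matroid_circuit (matroid_contract M {e}) D"
    "matroid_circuit (matroid_contract M {e}) D'" "W - {e} = D \<union> D'"
proof (cases "e \<in> W \<or> matroid_circuit (matroid_contract M {e}) W")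
  case True
  then have "matroid_circuit (matroid_contract M {e}) (W - {e})"
    using circuit_contract[OF W _ ne] by (cases "e \<in> W") auto
  then show ?thesis using that[of "W - {e}" "W - {e}"] by simp
next
  case False
  have "W \<subseteq> ground M - {e}" using False circuit_subset_ground[OF W] by blast
  moreover have "W \<notin> indeps (matroid_contract M {e})"
    using W False circuit_nonempty[OF W] unfolding indep_contract_iff[OF e]
    by (metis subset_insertI subset_singletonD insertI1)
  ultimately obtain D where D: "matroid_circuit (matroid_contract M {e}) D" "D \<subseteq> W"
    using matroid.dependent_contains_circuit[OF matroid_contract, of W e] by auto
  obtain Z where Z: "matroid_circuit M Z" "D = Z - {e}"
    using circuit_of_contract[OF D(1) e] .
  have "D \<noteq> W" using D(1) False by blast
  then have eZ: "e \<in> Z" using circuit_subset_eq[OF Z(1) W] Z(2) D(2) by auto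
  obtain f where f: "f \<in> D"
    using matroid.circuit_nonempty[OF matroid_contract D(1)] by blast
  have "f \<in> Z" "f \<in> W" "e \<notin> W" using f Z D(2) False by auto
  from strong_circuit_elimination[OF Z(1) W this(1,2) eZ this(3)]
  obtain Z' where Z': "matroid_circuit M Z'" "e \<in> Z'" "f \<notin> Z'" "Z' \<subseteq> Z \<union> W" .
  have sub: "Z \<union> Z' - {e} \<subseteq> W" using D(2) Z(2) Z'(4) by blast
  have "f \<in> Z" "Z \<noteq> Z'" using f Z Z' by auto
  obtain Y where Y: "matroid_circuit M Y" "e \<notin> Y" "Y \<subseteq> Z \<union> Z'"
    using strong_circuit_elimination[OF Z(1) Z'(1) eZ Z'(2) \<open>f \<in> Z\<close> Z'(3)] .
  have "Y = W" using circuit_subset_eq[OF Y(1) W] Y sub by blast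
  then have "W - {e} = D \<union> (Z' - {e})" using Y sub Z(2) by blast
  moreover have "Z' \<noteq> {e}"
    using circuit_subset_eq[OF Z'(1) Z(1)] eZ \<open>Z \<noteq> Z'\<close> by blast
  ultimately show ?thesis using that D(1) circuit_contract[OF Z'(1,2)] by blast
qed

lemma circuit_minus_cover_element:
  assumes "matroid_circuit M W" "e \<in> ground M" "x \<in> W" "x \<noteq> e"
  obtains D where "matroid_circuit (matroid_contract M {e}) D" "x \<in> D" "D \<subseteq> W - {e}"
proof -
  have "W \<noteq> {e}" using assms(3,4) by blast
  then obtain D D' where D: "matroid_circuit (matroid_contract M {e}) D"
    "matroid_circuit (matroid_contract M {e}) D'" "W - {e} = D \<union> D'"
    using circuit_minus_cover[OF assms(1,2)] by blast
  then have "x \<in> D \<or> x \<in> D'" using assms(3,4) by blast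
  then show ?thesis using that D by blast
qed

section \<open>Depth recursion\<close>

lemma contraction_depth_empty: "ground M = {} \<Longrightarrow> contraction_depth M = 0"
  by (subst contraction_depth.simps) simp

lemma contraction_depth_disconnected:
  assumes "\<not> matroid_connected M"
  shows "contraction_depth M =
    Max ((\<lambda>X. contraction_depth (matroid_restrict M X)) ` matroid_components M)"
  using assms finite_ground by (subst contraction_depth.simps) (auto simp: matroid_connected_def)

lemma contraction_depth_component_le:
  assumes "\<not> matroid_connected M" "X \<in> matroid_components M"
  shows "contraction_depth (matroid_restrict M X) \<le> contraction_depth M"
  unfolding contraction_depth_disconnected[OF assms(1)]
  using finite_components assms(2) by simp

lemma contraction_depth_le_components:
  assumes "\<not> matroid_connected M"
    "\<And>X. X \<in> matroid_components M \<Longrightarrow> contraction_depth (matroid_restrict M X) \<le> b"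
  shows "contraction_depth M \<le> b"
proof -
  have "ground M \<noteq> {}" using assms(1) by (auto simp: matroid_connected_def)
  then show ?thesis
    unfolding contraction_depth_disconnected[OF assms(1)]
    using finite_components components_nonempty assms(2) by simp
qed

lemma contraction_depth_connected:
  assumes "matroid_connected M" "ground M \<noteq> {}"
  shows "contraction_depth M =
    (LEAST k. \<exists>e \<in> ground M. contraction_depth (matroid_contract M {e}) + 1 \<le> k)"
  using assms finite_ground by (subst contraction_depth.simps) simp

lemma contraction_depth_le_contract:
  assumes "matroid_connected M" "e \<in> ground M"
  shows "contraction_depth M \<le> contraction_depth (matroid_contract M {e}) + 1"
proof -
  have "ground M \<noteq> {}" using assms(2) by blast
  then show ?thesis
    unfolding contraction_depth_connected[OF assms(1) \<open>ground M \<noteq> {}\<close>] using assms(2) by (intro Least_le) blast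
qed

lemma contraction_depth_contract_less:
  assumes "matroid_connected M" "ground M \<noteq> {}"
  obtains e where "e \<in> ground M" "contraction_depth (matroid_contract M {e}) < contraction_depth M"
proof -
  let ?P = "\<lambda>k. \<exists>e \<in> ground M. contraction_depth (matroid_contract M {e}) + 1 \<le> k"
  obtain e where "e \<in> ground M" using assms(2) by blast
  then have "?P (contraction_depth (matroid_contract M {e}) + 1)" by blast
  then have "?P (LEAST k. ?P k)" by (rule LeastI)
  then show ?thesis
    using that contraction_depth_connected[OF assms] by (metis Suc_eq_plus1 Suc_le_eq)
qed

lemma card_component_less:
  "\<lbrakk>\<not> matroid_connected M; X \<in> matroid_components M\<rbrakk>
    \<Longrightarrow> card (ground (matroid_restrict M X)) < card (ground M)"
  using card_ground_component_less[OF finite_ground] by simp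

lemma card_contract_less:
  "e \<in> ground M \<Longrightarrow> card (ground (matroid_contract M {e})) < card (ground M)"
  unfolding ground_contract by (rule card_Diff1_less[OF finite_ground])

end

section \<open>Circuit size bounded by contraction depth\<close>

text \<open>A circuit lies in one component, so splitting costs nothing. Contracting an element that
  attains the minimum lowers the depth, and the circuit is covered by two smaller instances: hence
  one factor 2 per level.\<close>

lemma circuit_card_le_contraction_depth:
  assumes "matroid M" "matroid_circuit M C"
  shows "card C \<le> 2 ^ contraction_depth M"
  using assms
proof (induction "card (ground M)" arbitrary: M C rule: less_induct)
  case less
  interpret matroid M by fact
  note C = less.prems(2)
  show ?case
  proof (cases "matroid_connected M")
    case False
    obtain x where x: "x \<in> C" using circuit_nonempty[OF C] by blast
    then obtain X where X: "X \<in> matroid_components M" "x \<in> X"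
      using element_in_component circuit_subset_ground[OF C] by blast
    then have "matroid_circuit (matroid_restrict M X) C"
      using circuit_subset_component[OF X(1) C] C x circuit_restrict_iff by blast
    then have "card C \<le> 2 ^ contraction_depth (matroid_restrict M X)"
      using less.hyps card_component_less[OF False X(1)] matroid_restrict by blast
    also have "\<dots> \<le> 2 ^ contraction_depth M"
      using contraction_depth_component_le[OF False X(1)] by simp
    finally show ?thesis .
  next
    case True
    moreover have "ground M \<noteq> {}" using circuit_nonempty[OF C] circuit_subset_ground[OF C] by blast
    ultimately obtain e where e: "e \<in> ground M"
      "contraction_depth (matroid_contract M {e}) < contraction_depth M"
      by (rule contraction_depth_contract_less)
    let ?k = "contraction_depth (matroid_contract M {e})"
    have IH: "card D \<le> 2 ^ ?k" if "matroid_circuit (matroid_contract M {e}) D" for D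
      using less.hyps[OF card_contract_less[OF e(1)] matroid_contract that] .
    have "card C \<le> 2 * 2 ^ ?k"
    proof (cases "C = {e}")
      case True
      have "(1::nat) \<le> 2 ^ ?k" by simp
      then show ?thesis unfolding True by simp
    next
      case False
      obtain D D' where D: "matroid_circuit (matroid_contract M {e}) D"
        "matroid_circuit (matroid_contract M {e}) D'" "C - {e} = D \<union> D'"
        using circuit_minus_cover[OF C e(1) False] .
      show ?thesis
      proof (cases "e \<in> C")
        case True
        then have "card (C - {e}) \<le> 2 ^ ?k" using circuit_contract[OF C _ False] IH by blast
        moreover have "card C = Suc (card (C - {e}))"
          using card_Suc_Diff1[OF finite_circuit[OF C] True] by simp
        \<comment> \<open>Here one circuit of the contraction suffices, and the second summand
          \<open>2 ^ ?k\<close> absorbs the element \<open>e\<close> itself.\<close>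
        moreover have "(1::nat) \<le> 2 ^ ?k" by simp
        ultimately show ?thesis by linarith
      next
        case False
        then have "card C \<le> card D + card D'" using D(3) card_Un_le by (metis Diff_empty Diff_insert0)
        then show ?thesis using IH[OF D(1)] IH[OF D(2)] by linarith
      qed
    qed
    also have "\<dots> = 2 ^ Suc ?k" by simp
    also have "\<dots> \<le> 2 ^ contraction_depth M" using e(2) by (intro power_increasing) auto
    finally show ?thesis .
  qed
qed

section \<open>Longest circuits\<close>

context matroid
begin

text \<open>In a graph, \<open>K'\<close> would follow the other arc of \<open>C\<close>. It comes
  from eliminating \<open>a\<close> in \<open>K \<inter> C\<close> from \<open>K\<close> and
  \<open>C\<close>. A circuit obtained from \<open>K\<close> and \<open>K'\<close> by eliminating
  \<open>l\<close> can only be \<open>C\<close> or \<open>D\<close>: keeping \<open>a\<close> yields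
  \<open>C \<subseteq> K \<union> K'\<close>, and keeping an element of \<open>K \<inter> D\<close>
  missing from \<open>K'\<close> would yield \<open>D \<subseteq> K\<close>.\<close>

lemma link_swap:
  assumes C: "matroid_circuit M C" and D: "matroid_circuit M D" and disj: "C \<inter> D = {}"
    and only: "\<And>Z. matroid_circuit M Z \<Longrightarrow> Z \<subseteq> C \<union> D \<Longrightarrow> Z = C \<or> Z = D"
    and K: "matroid_circuit M K" "K \<inter> C \<noteq> {}" "K \<inter> D \<noteq> {}"
    and L: "L = K - (C \<union> D)"
    and all_L: "\<And>Y. matroid_circuit M Y \<Longrightarrow> Y \<subseteq> C \<union> D \<union> L \<Longrightarrow> Y \<inter> L \<noteq> {} \<Longrightarrow> L \<subseteq> Y"
  obtains K' where "matroid_circuit M K'" "K' - (C \<union> D) = L" "K' \<inter> D = K \<inter> D" "C \<subseteq> K \<union> K'"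
proof -
  obtain a where a: "a \<in> K" "a \<in> C" using K(2) by blast
  have "\<not> K \<subseteq> C \<union> D"
    using only[OF K(1)] K(2,3) disj by blast
  then obtain l where l: "l \<in> L" "l \<in> K" "l \<notin> C" using L by blast
  obtain K' where K': "matroid_circuit M K'" "l \<in> K'" "a \<notin> K'" "K' \<subseteq> K \<union> C"
    using strong_circuit_elimination[OF K(1) C a l(2,3)] .
  have sub: "K \<union> K' \<subseteq> C \<union> D \<union> L" using K'(4) L by blast
  have outside: "K' - (C \<union> D) = L"
    using all_L[OF K'(1)] sub K'(2) l(1) L by blast
  \<comment> \<open>By \<open>all_L\<close>, a circuit that misses \<open>l\<close> misses the whole
    of \<open>L\<close> and so lies in \<open>C \<union> D\<close>.\<close>
  have elim: "Z \<subseteq> K \<union> K' \<Longrightarrow> l \<notin> Z \<Longrightarrow> matroid_circuit M Z \<Longrightarrow> Z = C \<or> Z = D" for Z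
    using only[of Z] all_L[of Z] sub l(1) by blast
  obtain Y where Y: "matroid_circuit M Y" "a \<in> Y" "l \<notin> Y" "Y \<subseteq> K \<union> K'"
    using strong_circuit_elimination[OF K(1) K'(1) l(2) K'(2) a(1) K'(3)] .
  have "Y = C" using elim[OF Y(4,3,1)] Y(2) a(2) disj by blast
  have "b \<in> K'" if b: "b \<in> K" "b \<in> D" for b
  proof (rule ccontr)
    assume "b \<notin> K'"
    obtain Z where Z: "matroid_circuit M Z" "b \<in> Z" "l \<notin> Z" "Z \<subseteq> K \<union> K'"
      using strong_circuit_elimination[OF K(1) K'(1) l(2) K'(2) b(1) \<open>b \<notin> K'\<close>] .
    have "Z = D" using elim[OF Z(4,3,1)] Z(2) b(2) disj by blast
    then have "D \<subseteq> K" using Z(4) K'(4) disj by blast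
    then show False using circuit_subset_eq[OF D K(1)] K(2) disj by blast
  qed
  then have "K' \<inter> D = K \<inter> D" using K'(4) disj by blast
  then show ?thesis using that[OF K'(1) outside] Y(4) \<open>Y = C\<close> by blast
qed

text \<open>As \<open>K\<close> and \<open>K'\<close> together cover \<open>C\<close>, one of them
  contains at least half of it. The trace on \<open>D\<close> and the set \<open>L\<close> are kept
  so that the lemma can be used again with \<open>C\<close> and \<open>D\<close> exchanged.\<close>

lemma link_swap_large:
  assumes C: "matroid_circuit M C" and D: "matroid_circuit M D" and disj: "C \<inter> D = {}"
    and only: "\<And>Z. matroid_circuit M Z \<Longrightarrow> Z \<subseteq> C \<union> D \<Longrightarrow> Z = C \<or> Z = D"
    and K: "matroid_circuit M K" "K \<inter> C \<noteq> {}" "K \<inter> D \<noteq> {}"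
    and L: "L = K - (C \<union> D)"
    and all_L: "\<And>Y. matroid_circuit M Y \<Longrightarrow> Y \<subseteq> C \<union> D \<union> L \<Longrightarrow> Y \<inter> L \<noteq> {} \<Longrightarrow> L \<subseteq> Y"
  obtains K' where "matroid_circuit M K'" "K' - (C \<union> D) = L" "K' \<inter> D = K \<inter> D"
    "card C \<le> 2 * card (K' \<inter> C)"
proof -
  obtain K' where K': "matroid_circuit M K'" "K' - (C \<union> D) = L" "K' \<inter> D = K \<inter> D" "C \<subseteq> K \<union> K'"
    using link_swap[OF assms] by blast
  have "C = (K \<inter> C) \<union> (K' \<inter> C)" using K'(4) by blast
  then have "card C \<le> card (K \<inter> C) + card (K' \<inter> C)" using card_Un_le by metis
  then consider "card C \<le> 2 * card (K \<inter> C)" | "card C \<le> 2 * card (K' \<inter> C)" by linarith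
  then show ?thesis
  proof cases
    case 1
    then show ?thesis using that[OF K(1)] L by simp
  next
    case 2
    then show ?thesis using that[OF K'(1-3)] by simp
  qed
qed

text \<open>As with two disjoint longest cycles of a 2-connected graph: a link \<open>K\<close> between
  disjoint longest circuits \<open>C\<close> and \<open>D\<close> can be rerouted to contain at least half of each,
  and then it is longer than both.\<close>

lemma card_minimal_outside_longest_circuit:
  assumes conn: "matroid_connected M" and C: "matroid_circuit M C"
    and longest: "\<And>Z. matroid_circuit M Z \<Longrightarrow> card Z \<le> card C"
    and D: "matroid_circuit M D" "D - C \<noteq> {}"
    and min: "\<And>Z. matroid_circuit M Z \<Longrightarrow> Z - C \<noteq> {} \<Longrightarrow> \<not> Z - C \<subset> D - C"
  shows "card (D - C) < card C"
proof (rule ccontr)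
  assume "\<not> ?thesis"
  then have ge: "card C \<le> card (D - C)" by simp
  have fin: "finite C" "finite D" using finite_circuit C D(1) by auto
  \<comment> \<open>\<open>D\<close> has at most \<open>card C\<close> elements, and at least that
    many of them lie outside \<open>C\<close>, so it is disjoint from \<open>C\<close>.\<close>
  have "card D \<le> card (D - C)" using ge longest[OF D(1)] by simp
  then have "D - C = D" using card_seteq[OF fin(2), of "D - C"] by blast
  then have disj: "C \<inter> D = {}" by blast
  have card_D: "card C \<le> card D" using ge \<open>D - C = D\<close> by simp
  have only: "Z = C \<or> Z = D" if Z: "matroid_circuit M Z" "Z \<subseteq> C \<union> D" for Z
  proof (cases "Z \<subseteq> C")
    case True
    then show ?thesis using circuit_subset_eq[OF Z(1) C] by simp
  next
    case False
    then have "D \<subseteq> Z" using min[OF Z(1)] Z(2) disj by blast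
    then show ?thesis using circuit_subset_eq[OF D(1) Z(1)] by simp
  qed
  define link where "link = (\<lambda>K. matroid_circuit M K \<and> K \<inter> C \<noteq> {} \<and> K \<inter> D \<noteq> {})"
  obtain c d where cd: "c \<in> C" "d \<in> D" using circuit_nonempty[OF C] circuit_nonempty[OF D(1)] by blast
  have "c \<in> ground M" "d \<in> ground M" "c \<noteq> d"
    using cd disj circuit_subset_ground[OF C] circuit_subset_ground[OF D(1)] by auto
  then obtain K0 where "matroid_circuit M K0" "c \<in> K0" "d \<in> K0"
    using connected_circuit[OF conn] by blast
  then have "link K0" using cd unfolding link_def by blast
  \<comment> \<open>Taking a link with fewest elements outside \<open>C \<union> D\<close> makes
    every link inside \<open>C \<union> D \<union> L\<close> contain all of
    \<open>L\<close>.\<close>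
  then obtain K where K: "link K"
    and K_min: "\<And>K'. link K' \<Longrightarrow> card (K - (C \<union> D)) \<le> card (K' - (C \<union> D))"
    using ex_has_least_nat[of link K0 "\<lambda>K. card (K - (C \<union> D))"] by blast
  have Kc: "matroid_circuit M K" "K \<inter> C \<noteq> {}" "K \<inter> D \<noteq> {}" using K by (auto simp: link_def)
  define L where "L = K - (C \<union> D)"
  have finL: "finite L" using finite_circuit[OF Kc(1)] by (simp add: L_def)
  have link_L: "L \<subseteq> Y" if "link Y" "Y \<subseteq> C \<union> D \<union> L" for Y
  proof -
    have "Y - (C \<union> D) \<subseteq> L" using that(2) by blast
    then have "Y - (C \<union> D) = L" using card_seteq[OF finL] K_min[OF that(1)] by (simp add: L_def)
    then show ?thesis by blast
  qed
  \<comment> \<open>If \<open>Y\<close> misses \<open>B\<close>, eliminating \<open>l\<close> from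
    \<open>K\<close> and \<open>Y\<close> while keeping some \<open>b\<close> in
    \<open>K \<inter> B\<close> gives a circuit \<open>Z\<close> without \<open>l\<close>. It is no
    link, so it misses \<open>A\<close>, and what it takes from \<open>Y\<close> lies in
    \<open>L\<close>. Then \<open>Z\<close> is a circuit properly inside \<open>K\<close>.\<close>
  have meets: "Y \<inter> B \<noteq> {}"
    if Y: "matroid_circuit M Y" "Y \<subseteq> C \<union> D \<union> L" "Y \<inter> L \<noteq> {}"
      and AB: "(A = C \<and> B = D) \<or> (A = D \<and> B = C)" for Y A B
  proof
    assume YB: "Y \<inter> B = {}"
    obtain l b where l: "l \<in> Y" "l \<in> L" and b: "b \<in> K" "b \<in> B" using Y(3) Kc AB by blast
    have "l \<in> K" "b \<notin> Y" using l b YB by (auto simp: L_def)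
    obtain Z where Z: "matroid_circuit M Z" "b \<in> Z" "l \<notin> Z" "Z \<subseteq> K \<union> Y"
      using strong_circuit_elimination[OF Kc(1) Y(1) \<open>l \<in> K\<close> l(1) b(1) \<open>b \<notin> Y\<close>] .
    have "Z \<subseteq> C \<union> D \<union> L" using Z(4) Y(2) by (auto simp: L_def)
    then have "\<not> link Z" using link_L[of Z] Z(3) l(2) by blast
    then have "Z \<inter> A = {}" using Z(1,2) b(2) AB unfolding link_def by blast
    then have "Z \<subseteq> K" using Z(4) Y(2) YB AB by (auto simp: L_def)
    then show False using circuit_subset_eq[OF Z(1) Kc(1)] Z(3) \<open>l \<in> K\<close> by blast
  qed
  have all_L: "L \<subseteq> Y" if Y: "matroid_circuit M Y" "Y \<subseteq> C \<union> D \<union> L" "Y \<inter> L \<noteq> {}" for Y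
    using meets[OF Y, of C D] meets[OF Y, of D C] link_L[OF _ Y(2)] Y(1)
    unfolding link_def by blast
  obtain K1 where K1: "matroid_circuit M K1" "K1 - (C \<union> D) = L" "K1 \<inter> D = K \<inter> D"
    "card C \<le> 2 * card (K1 \<inter> C)"
    using link_swap_large[OF C D(1) disj only Kc L_def all_L] by blast
  have "0 < card C" using circuit_nonempty[OF C] fin(1) by (simp add: card_gt_0_iff)
  then have "0 < card (K1 \<inter> C)" using K1(4) by linarith
  then have "K1 \<inter> C \<noteq> {}" by force
  have K1D: "K1 \<inter> D \<noteq> {}" using K1(3) Kc(3) by simp
  have flip: "D \<inter> C = {}" "L = K1 - (D \<union> C)" using disj K1(2) by auto
  have only': "Z = D \<or> Z = C" if "matroid_circuit M Z" "Z \<subseteq> D \<union> C" for Z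
    using only[OF that(1)] that(2) by blast
  have all_L': "L \<subseteq> Y" if "matroid_circuit M Y" "Y \<subseteq> D \<union> C \<union> L" "Y \<inter> L \<noteq> {}" for Y
    using all_L[OF that(1)] that(2,3) by blast
  \<comment> \<open>The second swap enlarges the part in \<open>D\<close> and fixes the part in
    \<open>C\<close>, so \<open>K2\<close> contains at least half of each.\<close>
  obtain K2 where K2: "matroid_circuit M K2" "K2 - (D \<union> C) = L" "K2 \<inter> C = K1 \<inter> C"
    "card D \<le> 2 * card (K2 \<inter> D)"
    using link_swap_large[OF D(1) C flip(1) only' K1(1) K1D \<open>K1 \<inter> C \<noteq> {}\<close> flip(2) all_L'] by blast
  \<comment> \<open>The two halves only add up to \<open>card C\<close>; the nonempty
    \<open>L\<close> makes \<open>K2\<close> strictly longer.\<close>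
  have "L \<noteq> {}"
    using only[OF Kc(1)] Kc(2,3) disj unfolding L_def by blast
  then have "0 < card L" using finL by (simp add: card_gt_0_iff)
  have finK2: "finite K2" using finite_circuit[OF K2(1)] .
  have "K2 = L \<union> (K2 \<inter> C \<union> K2 \<inter> D)" using K2(2) by blast
  then have "card K2 = card L + card (K2 \<inter> C \<union> K2 \<inter> D)"
    using card_Un_disjoint[of L "K2 \<inter> C \<union> K2 \<inter> D"] finL finK2 K2(2) by fastforce
  also have "card (K2 \<inter> C \<union> K2 \<inter> D) = card (K2 \<inter> C) + card (K2 \<inter> D)"
    using finK2 disj by (intro card_Un_disjoint) auto
  finally have "card C < card K2"
    using K1(4) K2(3,4) card_D \<open>0 < card L\<close> by simp
  then show False using longest[OF K2(1)] by simp
qed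

end

text \<open>The circuits of \<open>M / X\<close> are the minimal nonempty sets \<open>W - X\<close> for circuits \<open>W\<close> of \<open>M\<close>;
  speaking of these avoids contracting more than one element at a time.\<close>

definition contracted_circuits_le :: "'a matroid_system \<Rightarrow> 'a set \<Rightarrow> nat \<Rightarrow> bool" where
  "contracted_circuits_le M X n \<longleftrightarrow>
     (\<forall>W. matroid_circuit M W \<and> W - X \<noteq> {} \<and>
        (\<forall>Z. matroid_circuit M Z \<and> Z - X \<noteq> {} \<longrightarrow> \<not> Z - X \<subset> W - X) \<longrightarrow> card (W - X) \<le> n)"

text \<open>Minimality inside \<open>Y\<close> is minimality in \<open>M\<close>: a circuit whose
  part outside \<open>X\<close> is nonempty and lies in \<open>W - X\<close> meets the component
  \<open>Y\<close> and is therefore contained in it.\<close>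

lemma (in matroid) contracted_circuits_le_restrict:
  assumes "Y \<in> matroid_components M" "contracted_circuits_le M X n"
  shows "contracted_circuits_le (matroid_restrict M Y) (X \<inter> Y) n"
  unfolding contracted_circuits_le_def circuit_restrict_iff
proof (intro allI impI, elim conjE)
  fix W assume W: "matroid_circuit M W" "W \<subseteq> Y" "W - X \<inter> Y \<noteq> {}"
    and min: "\<forall>Z. (matroid_circuit M Z \<and> Z \<subseteq> Y) \<and> Z - X \<inter> Y \<noteq> {} \<longrightarrow> \<not> Z - X \<inter> Y \<subset> W - X \<inter> Y"
  have diff: "Z - X \<inter> Y = Z - X" if "Z \<subseteq> Y" for Z using that by blast
  have "\<not> Z - X \<subset> W - X" if Z: "matroid_circuit M Z" "Z - X \<noteq> {}" for Z
  proof
    assume less: "Z - X \<subset> W - X"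
    then have "Z \<inter> Y \<noteq> {}" using Z(2) W(2) by blast
    then have "Z \<subseteq> Y" using circuit_subset_component[OF assms(1) Z(1)] by simp
    then show False using min Z less W(2) diff by metis
  qed
  then have "card (W - X) \<le> n"
    using assms(2) W diff unfolding contracted_circuits_le_def by simp
  then show "card (W - X \<inter> Y) \<le> n" using diff W(2) by simp
qed

text \<open>Contracting \<open>e\<close> and then \<open>X - {e}\<close> amounts to contracting
  \<open>X\<close>. If a circuit \<open>Z\<close> of \<open>M\<close> had a smaller part outside
  \<open>X\<close>, a circuit of \<open>M / e\<close> inside \<open>Z - {e}\<close> through an
  element outside \<open>X\<close> would violate the minimality of \<open>V\<close>.\<close>

lemma (in matroid) contracted_circuits_le_contract:
  assumes e: "e \<in> ground M" "e \<in> X" and le: "contracted_circuits_le M X n"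
  shows "contracted_circuits_le (matroid_contract M {e}) (X - {e}) n"
  unfolding contracted_circuits_le_def
proof (intro allI impI, elim conjE)
  fix V assume V: "matroid_circuit (matroid_contract M {e}) V" "V - (X - {e}) \<noteq> {}"
    and min: "\<forall>Z. matroid_circuit (matroid_contract M {e}) Z \<and> Z - (X - {e}) \<noteq> {} \<longrightarrow>
      \<not> Z - (X - {e}) \<subset> V - (X - {e})"
  have diff: "Z - (X - {e}) = Z - X" if "e \<notin> Z" for Z using that by blast
  obtain W where W: "matroid_circuit M W" "V = W - {e}"
    using circuit_of_contract[OF V(1) e(1)] .
  have VW: "V - (X - {e}) = W - X" using W(2) e(2) by blast
  have "\<not> Z - X \<subset> W - X" if Z: "matroid_circuit M Z" "Z - X \<noteq> {}" for Z
  proof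
    assume less: "Z - X \<subset> W - X"
    obtain x where x: "x \<in> Z" "x \<notin> X" using Z(2) by blast
    then have "x \<noteq> e" using e(2) by blast
    obtain D where D: "matroid_circuit (matroid_contract M {e}) D" "x \<in> D" "D \<subseteq> Z - {e}"
      using circuit_minus_cover_element[OF Z(1) e(1) x(1) \<open>x \<noteq> e\<close>] .
    have "D - (X - {e}) \<subset> V - (X - {e})" using less D(3) unfolding VW by blast
    moreover have "D - (X - {e}) \<noteq> {}" using D(2) x(2) by blast
    ultimately show False using min D(1) by blast
  qed
  then have "card (W - X) \<le> n"
    using le W(1) V(2) unfolding contracted_circuits_le_def VW by simp
  then show "card (V - (X - {e})) \<le> n" unfolding VW .
qed

section \<open>Contraction depth bounded by circuit size\<close>

text \<open>\<open>X\<close> is what remains of a circuit being contracted, and each of its elements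
  pays for one level. Once \<open>X\<close> is empty and \<open>M\<close> is connected, a longest
  circuit with \<open>m + 1\<close> elements takes its place and \<open>n\<close> drops to
  \<open>m\<close>; the sum is bounded because
  \<open>(m + 1) + m * m \<le> (m + 1) * (m + 1)\<close>.\<close>

lemma contraction_depth_le_contracted_circuits:
  assumes "matroid M" "contracted_circuits_le M X n" "X \<subseteq> ground M"
  shows "contraction_depth M \<le> card X + n * n + 1"
  using assms
proof (induction "card (ground M)" arbitrary: M X n rule: less_induct)
  case less
  interpret matroid M by fact
  note le = less.prems(2)
  have finX: "finite X" using less.prems(3) finite_ground finite_subset by blast
  \<comment> \<open>This is stated for arbitrary \<open>X'\<close> and \<open>n'\<close> because it
    serves both the current \<open>X\<close> and a newly chosen longest circuit.\<close>
  have contract: "contraction_depth M \<le> card X' + n' * n' + 1"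
    if conn: "matroid_connected M" and X': "contracted_circuits_le M X' n'" "X' \<subseteq> ground M" "e \<in> X'"
    for e X' n'
  proof -
    have e: "e \<in> ground M" using X' by blast
    have "contraction_depth (matroid_contract M {e}) \<le> card (X' - {e}) + n' * n' + 1"
      using X'(2) by (intro less.hyps[OF card_contract_less[OF e] matroid_contract
            contracted_circuits_le_contract[OF e X'(3,1)]]) auto
    moreover have "card X' = Suc (card (X' - {e}))"
      using card_Suc_Diff1[OF finite_subset[OF X'(2) finite_ground] X'(3)] by simp
    ultimately show ?thesis
      using contraction_depth_le_contract[OF conn e] by linarith
  qed
  show ?case
  proof (cases "matroid_connected M")
    case False
    show ?thesis
    proof (rule contraction_depth_le_components[OF False])
      fix Y assume Y: "Y \<in> matroid_components M"
      have "contraction_depth (matroid_restrict M Y) \<le> card (X \<inter> Y) + n * n + 1"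
        using less.prems(3) by (intro less.hyps[OF card_component_less[OF False Y] matroid_restrict
              contracted_circuits_le_restrict[OF Y le]]) auto
      also have "card (X \<inter> Y) \<le> card X" using finX by (intro card_mono) auto
      finally show "contraction_depth (matroid_restrict M Y) \<le> card X + n * n + 1" by simp
    qed
  next
    case conn: True
    show ?thesis
    proof (cases "X = {}")
      case False
      then show ?thesis using contract[OF conn le less.prems(3)] by blast
    next
      case X: True
      have le_n: "card C \<le> n" if C: "matroid_circuit M C" for C
      proof -
        have "\<not> Z \<subset> C" if "matroid_circuit M Z" for Z
          using circuit_subset_eq[OF that C] by blast
        then show ?thesis
          using le C circuit_nonempty[OF C] unfolding contracted_circuits_le_def X by simp
      qed
      show ?thesis
      proof (cases "\<exists>C. matroid_circuit M C")
        case True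
        have "\<forall>C. matroid_circuit M C \<longrightarrow> card C < Suc n" using le_n by (simp add: less_Suc_eq_le)
        with True obtain C where C: "matroid_circuit M C"
          and longest: "\<And>Z. matroid_circuit M Z \<Longrightarrow> card Z \<le> card C"
          using ex_has_greatest_nat[of "matroid_circuit M" _ card "Suc n"] by blast
        define m where "m = card C - 1"
        have "0 < card C"
          using circuit_nonempty[OF C] finite_circuit[OF C] by (simp add: card_gt_0_iff)
        then have m: "card C = Suc m" by (simp add: m_def)
        have "card (W - C) \<le> m" if "matroid_circuit M W" "W - C \<noteq> {}"
          "\<And>Z. matroid_circuit M Z \<Longrightarrow> Z - C \<noteq> {} \<Longrightarrow> \<not> Z - C \<subset> W - C" for W
          using card_minimal_outside_longest_circuit[OF conn C longest that] m by simp
        then have "contracted_circuits_le M C m" unfolding contracted_circuits_le_def by simp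
        moreover obtain e where "e \<in> C" using circuit_nonempty[OF C] by blast
        ultimately have "contraction_depth M \<le> card C + m * m + 1"
          using contract[OF conn _ circuit_subset_ground[OF C]] by blast
        also have "\<dots> \<le> Suc m * Suc m + 1" using m by simp
        also have "\<dots> \<le> n * n + 1"
          using mult_le_mono[OF le_n[OF C] le_n[OF C]] unfolding m by simp
        finally show ?thesis by simp
      next
        \<comment> \<open>A connected matroid without circuits has at most one element; its depth is
          at most 1, the last summand of the bound.\<close>
        case no_circuit: False
        have single: "e = f" if "e \<in> ground M" "f \<in> ground M" for e f
          using connected_circuit[OF conn that] no_circuit by blast
        show ?thesis
        proof (cases "ground M = {}")
          case True
          then show ?thesis by (simp add: contraction_depth_empty)
        next
          case False
          then obtain e where e: "e \<in> ground M" by blast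
          then have "ground (matroid_contract M {e}) = {}" using single by auto
          then have "contraction_depth (matroid_contract M {e}) = 0"
            using matroid.contraction_depth_empty[OF matroid_contract] by blast
          then show ?thesis using contraction_depth_le_contract[OF conn e] by simp
        qed
      qed
    qed
  qed
qed

lemma contraction_depth_le_circuit_card:
  assumes "matroid M" "\<And>C. matroid_circuit M C \<Longrightarrow> card C \<le> n"
  shows "contraction_depth M \<le> n * n + 1"
  using contraction_depth_le_contracted_circuits[OF assms(1), of "{}" n] assms(2)
  by (simp add: contracted_circuits_le_def)

section \<open>Duality\<close>

context matroid
begin

text \<open>With a basis \<open>B\<close> containing \<open>C - {e}\<close>, the fundamental cocircuit of \<open>f\<close> contains \<open>e\<close>.\<close>

lemma cocircuit_through_circuit_pair:
  assumes C: "matroid_circuit M C" and ef: "e \<in> C" "f \<in> C" "e \<noteq> f"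
  obtains D where "matroid_circuit (matroid_dual M) D" "e \<in> D" "f \<in> D"
proof -
  have "C - {e} \<in> indeps M" using circuit_psubset_indep[OF C, of "C - {e}"] ef by blast
  then obtain B where B: "matroid_basis M B" "C - {e} \<subseteq> B" by (rule indep_subset_basis)
  define A where "A = B - {f}"
  \<comment> \<open>\<open>D\<close> is the complement of the hyperplane spanned by
    \<open>A\<close>, that is, the fundamental cocircuit of \<open>f\<close>.\<close>
  define D where "D = {x \<in> ground M. x \<notin> A \<and> insert x A \<in> indeps M}"
  have indB: "B \<in> indeps M" using B(1) by (simp add: matroid_basis_def)
  have fB: "f \<in> B" using B(2) ef by blast
  have indA: "A \<in> indeps M" using indep_mono[OF indB] by (simp add: A_def)
  have finA: "finite A" using finite_indep[OF indA] .
  have card_B: "card B = Suc (card A)"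
    using card_Suc_Diff1[OF finite_indep[OF indB] fB] by (simp add: A_def)
  have basis: "matroid_basis M (insert x A)" if "x \<in> D" for x
  proof -
    have x: "x \<notin> A" "insert x A \<in> indeps M" using that by (auto simp: D_def)
    then obtain B' where B': "matroid_basis M B'" "insert x A \<subseteq> B'" using indep_subset_basis by blast
    have "finite B'" using B'(1) finite_indep by (simp add: matroid_basis_def)
    moreover have "card B' \<le> card (insert x A)"
      using basis_card_eq[OF B'(1) B(1)] card_B x(1) finA by simp
    ultimately show ?thesis using card_seteq[of B' "insert x A"] B' by simp
  qed
  have "f \<in> D"
    using fB indB basis_subset_ground[OF B(1)] by (auto simp: D_def A_def insert_absorb)
  have "B \<subseteq> ground M" using basis_subset_ground[OF B(1)] .
  have "e \<notin> B" using circuit_not_indep[OF C, of B] B(2) indB by blast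
  \<comment> \<open>Otherwise a circuit through \<open>e\<close> avoids \<open>f\<close>, and
    eliminating \<open>e\<close> from it and \<open>C\<close> leaves a circuit inside
    \<open>B\<close>.\<close>
  have "insert e A \<in> indeps M"
  proof (rule ccontr)
    assume "insert e A \<notin> indeps M"
    moreover have "insert e A \<subseteq> ground M"
      using \<open>B \<subseteq> ground M\<close> circuit_subset_ground[OF C] ef by (auto simp: A_def)
    ultimately obtain Z where Z: "matroid_circuit M Z" "Z \<subseteq> insert e A"
      using dependent_contains_circuit by metis
    then have "e \<in> Z" using circuit_not_indep[OF Z(1), of A] indA by blast
    have "f \<notin> Z" using Z(2) ef(3) by (auto simp: A_def)
    obtain Y where Y: "matroid_circuit M Y" "e \<notin> Y" "Y \<subseteq> C \<union> Z"
      using strong_circuit_elimination[OF C Z(1) ef(1) \<open>e \<in> Z\<close> ef(2) \<open>f \<notin> Z\<close>] .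
    have "Y \<subseteq> B" using Y(2,3) Z(2) B(2) by (auto simp: A_def)
    then show False using circuit_not_indep[OF Y(1)] indB by blast
  qed
  then have "e \<in> D"
    using \<open>e \<notin> B\<close> circuit_subset_ground[OF C] ef(1) by (auto simp: D_def A_def)
  \<comment> \<open>A basis avoiding \<open>D\<close> would augment \<open>A\<close> by one of its
    elements, which would then belong to \<open>D\<close>.\<close>
  have "D \<notin> indeps (matroid_dual M)"
  proof
    assume "D \<in> indeps (matroid_dual M)"
    then obtain B' where B': "matroid_basis M B'" "D \<subseteq> ground M - B'"
      unfolding indep_dual_iff by blast
    have "card A < card B'" using basis_card_eq[OF B'(1) B(1)] card_B by simp
    moreover have "B' \<in> indeps M" using B'(1) by (simp add: matroid_basis_def)
    ultimately obtain x where "x \<in> B' - A" "insert x A \<in> indeps M"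
      using augment[OF indA] by blast
    then show False using B' basis_subset_ground[OF B'(1)] by (auto simp: D_def)
  qed
  moreover have "S \<in> indeps (matroid_dual M)" if "S \<subset> D" for S
  proof -
    obtain x where x: "x \<in> D" "x \<notin> S" using \<open>S \<subset> D\<close> by blast
    have "S \<subseteq> ground M - insert x A" using that x(2) by (auto simp: D_def)
    then show ?thesis unfolding indep_dual_iff using basis[OF x(1)] by blast
  qed
  moreover have "D \<subseteq> ground (matroid_dual M)" by (auto simp: D_def ground_dual)
  ultimately have "matroid_circuit (matroid_dual M) D" by (simp add: matroid_circuit_def)
  then show ?thesis using that \<open>e \<in> D\<close> \<open>f \<in> D\<close> by blast
qed

lemma circuit_rel_subset_dual: "circuit_rel M \<subseteq> circuit_rel (matroid_dual M)"
proof (rule subrelI)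
  fix e f assume ef: "(e, f) \<in> circuit_rel M"
  show "(e, f) \<in> circuit_rel (matroid_dual M)"
  proof (cases "e = f")
    case False
    then obtain C where "matroid_circuit M C" "e \<in> C" "f \<in> C"
      using ef unfolding circuit_rel_def by blast
    then obtain D where "matroid_circuit (matroid_dual M) D" "e \<in> D" "f \<in> D"
      using cocircuit_through_circuit_pair False by metis
    then show ?thesis using ef unfolding circuit_rel_def ground_dual by blast
  qed (use ef in \<open>auto simp: circuit_rel_def ground_dual\<close>)
qed

lemma circuit_rel_dual: "circuit_rel (matroid_dual M) = circuit_rel M"
  using circuit_rel_subset_dual matroid.circuit_rel_subset_dual[OF matroid_dual]
  unfolding dual_dual by (rule equalityI[rotated])

lemma components_dual: "matroid_components (matroid_dual M) = matroid_components M"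
  by (simp add: matroid_components_def circuit_rel_dual ground_dual)

lemma connected_dual: "matroid_connected (matroid_dual M) = matroid_connected M"
  by (simp add: matroid_connected_def components_dual ground_dual)

lemma contract_dual: "matroid_contract (matroid_dual M) X = matroid_dual (matroid_delete M X)"
  by (simp add: matroid_contract_def dual_dual)

text \<open>An element \<open>x\<close> of a larger independent set in \<open>X\<close> closes a
  circuit with \<open>B\<close>. This circuit contains \<open>x\<close>, so it stays in the
  component and hence inside that independent set.\<close>

lemma basis_Int_component:
  assumes X: "X \<in> matroid_components M" and B: "matroid_basis M B"
  shows "matroid_basis (matroid_restrict M X) (B \<inter> X)"
proof -
  have XE: "X \<subseteq> ground M" using component_subset_ground[OF X] .
  have indB: "B \<in> indeps M" using B by (simp add: matroid_basis_def)
  have ind_iff: "I \<in> indeps (matroid_restrict M X) \<longleftrightarrow> I \<in> indeps M \<and> I \<subseteq> X" for I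
    using XE by (auto simp: matroid_restrict_def matroid_delete_def)
  have "I = B \<inter> X" if I: "I \<in> indeps M" "I \<subseteq> X" "B \<inter> X \<subseteq> I" for I
  proof (rule ccontr)
    assume "I \<noteq> B \<inter> X"
    then obtain x where x: "x \<in> I" "x \<notin> B" using I by blast
    have "insert x B \<notin> indeps M"
      using B x(2) unfolding matroid_basis_def by blast
    moreover have "insert x B \<subseteq> ground M" using basis_subset_ground[OF B] XE I(2) x(1) by blast
    ultimately obtain Z where Z: "matroid_circuit M Z" "Z \<subseteq> insert x B"
      using dependent_contains_circuit by metis
    have "x \<in> Z" using circuit_not_indep[OF Z(1), of B] indB Z(2) by blast
    then have "Z \<subseteq> X" using circuit_subset_component[OF X Z(1)] x(1) I(2) by blast
    then have "Z \<subseteq> I" using Z(2) I(3) x(1) by blast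
    then show False using circuit_not_indep[OF Z(1)] I(1) by blast
  qed
  moreover have "B \<inter> X \<in> indeps M" using indep_mono[OF indB] by simp
  ultimately show ?thesis
    unfolding matroid_basis_def Ball_def ind_iff by simp
qed

text \<open>For an arbitrary \<open>X\<close> the right side is a contraction of the dual, not a
  restriction. For a component the two agree, because every basis of \<open>M\<close> cuts
  \<open>X\<close> in a basis of the restriction.\<close>

lemma restrict_dual_component:
  assumes X: "X \<in> matroid_components M"
  shows "matroid_restrict (matroid_dual M) X = matroid_dual (matroid_restrict M X)"
proof -
  have XE: "X \<subseteq> ground M" using component_subset_ground[OF X] .
  have "I \<in> indeps (matroid_restrict (matroid_dual M) X) \<longleftrightarrow>
      I \<in> indeps (matroid_dual (matroid_restrict M X))" for I
  proof
    assume "I \<in> indeps (matroid_restrict (matroid_dual M) X)"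
    then obtain B where B: "matroid_basis M B" "I \<subseteq> ground M - B" "I \<subseteq> X"
      using XE by (auto simp: matroid_restrict_def matroid_delete_def matroid_dual_def)
    have "I \<subseteq> ground (matroid_restrict M X) - B \<inter> X" using B by auto
    then show "I \<in> indeps (matroid_dual (matroid_restrict M X))"
      using basis_Int_component[OF X B(1)] matroid.indep_dual_iff[OF matroid_restrict] by blast
  next
    assume "I \<in> indeps (matroid_dual (matroid_restrict M X))"
    then obtain A where A: "matroid_basis (matroid_restrict M X) A" "I \<subseteq> ground M \<inter> X - A"
      using matroid.indep_dual_iff[OF matroid_restrict] by auto
    have ind_A: "A \<in> indeps M"
      using A(1) by (auto simp: matroid_basis_def matroid_restrict_def matroid_delete_def)
    then obtain B where B: "matroid_basis M B" "A \<subseteq> B" by (rule indep_subset_basis)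
    have "A \<subseteq> X"
      using A(1) XE by (auto simp: matroid_basis_def matroid_restrict_def matroid_delete_def)
    then have "A \<subseteq> B \<inter> X" using B(2) by simp
    then have "B \<inter> X = A"
      using A(1) basis_Int_component[OF X B(1)]
      unfolding matroid_basis_def[of "matroid_restrict M X"] by simp
    then have "I \<subseteq> ground M - B" "I \<subseteq> X" using A(2) by auto
    then show "I \<in> indeps (matroid_restrict (matroid_dual M) X)"
      using B(1) XE by (auto simp: matroid_restrict_def matroid_delete_def matroid_dual_def)
  qed
  then show ?thesis
    by (intro matroid_system.equality) (auto simp: matroid.ground_dual[OF matroid_restrict] ground_dual)
qed

end

text \<open>Both recursions take the same branch, since duality preserves components, and their
  recursive calls match: deleting \<open>e\<close> from \<open>M\<close> dualises to contracting
  \<open>e\<close> in the dual.\<close>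

lemma deletion_depth_eq_contraction_depth_dual:
  assumes "matroid M"
  shows "deletion_depth M = contraction_depth (matroid_dual M)"
  using assms
proof (induction "card (ground M)" arbitrary: M rule: less_induct)
  case less
  interpret matroid M by fact
  interpret dual: matroid "matroid_dual M" by (rule matroid_dual)
  show ?case
  proof (cases "ground M = {}")
    case True
    then show ?thesis
      using dual.contraction_depth_empty by (subst deletion_depth.simps) (simp add: ground_dual)
  next
    case ne: False
    show ?thesis
    proof (cases "matroid_connected M")
      case False
      have "deletion_depth (matroid_restrict M X) = contraction_depth (matroid_restrict (matroid_dual M) X)"
        if X: "X \<in> matroid_components M" for X
        unfolding restrict_dual_component[OF X]
        using less.hyps[OF card_component_less[OF False X] matroid_restrict] .
      then show ?thesis
        using ne False finite_ground dual.contraction_depth_disconnected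
        by (subst deletion_depth.simps) (simp add: connected_dual components_dual)
    next
      case True
      have "deletion_depth (matroid_delete M {e}) = contraction_depth (matroid_contract (matroid_dual M) {e})"
        if e: "e \<in> ground M" for e
        unfolding contract_dual using card_contract_less[OF e] by (intro less.hyps matroid_delete) simp
      then show ?thesis
        using ne True finite_ground dual.contraction_depth_connected
        by (subst deletion_depth.simps) (simp add: connected_dual ground_dual)
    qed
  qed
qed

section \<open>Boundedness over classes of matroids\<close>

lemma bounded_contraction_depth_iff:
  assumes "\<And>M. M \<in> \<C> \<Longrightarrow> matroid M"
  shows "(\<exists>k. \<forall>M \<in> \<C>. contraction_depth M \<le> k) \<longleftrightarrow>
    (\<exists>N. \<forall>M \<in> \<C>. \<forall>C. matroid_circuit M C \<longrightarrow> card C \<le> N)"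
proof
  assume "\<exists>k. \<forall>M \<in> \<C>. contraction_depth M \<le> k"
  then obtain k where k: "\<And>M. M \<in> \<C> \<Longrightarrow> contraction_depth M \<le> k" by blast
  have "card C \<le> 2 ^ k" if M: "M \<in> \<C>" and C: "matroid_circuit M C" for M C
  proof -
    have "card C \<le> 2 ^ contraction_depth M"
      using circuit_card_le_contraction_depth[OF assms[OF M] C] .
    also have "\<dots> \<le> 2 ^ k" using k[OF M] by simp
    finally show ?thesis .
  qed
  then show "\<exists>N. \<forall>M \<in> \<C>. \<forall>C. matroid_circuit M C \<longrightarrow> card C \<le> N" by blast
next
  assume "\<exists>N. \<forall>M \<in> \<C>. \<forall>C. matroid_circuit M C \<longrightarrow> card C \<le> N"
  then obtain N where N: "\<And>M C. M \<in> \<C> \<Longrightarrow> matroid_circuit M C \<Longrightarrow> card C \<le> N" by blast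
  have "contraction_depth M \<le> N * N + 1" if "M \<in> \<C>" for M
    using contraction_depth_le_circuit_card[OF assms[OF that] N[OF that]] .
  then show "\<exists>k. \<forall>M \<in> \<C>. contraction_depth M \<le> k" by blast
qed

theorem theorem5p8:
  fixes \<C> :: "'a matroid_system set"
  assumes "\<And>M. M \<in> \<C> \<Longrightarrow> matroid M"
  shows "((\<exists>k::nat. \<forall>M \<in> \<C>. contraction_depth M \<le> k) \<longleftrightarrow>
          (\<exists>N::nat. \<forall>M \<in> \<C>. \<forall>C. matroid_circuit M C \<longrightarrow> card C \<le> N))
       \<and> ((\<exists>k::nat. \<forall>M \<in> \<C>. deletion_depth M \<le> k) \<longleftrightarrow>
          (\<exists>N::nat. \<forall>M \<in> \<C>. \<forall>C. matroid_cocircuit M C \<longrightarrow> card C \<le> N))"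
proof (rule conjI)
  show "(\<exists>k. \<forall>M \<in> \<C>. contraction_depth M \<le> k) \<longleftrightarrow>
      (\<exists>N. \<forall>M \<in> \<C>. \<forall>C. matroid_circuit M C \<longrightarrow> card C \<le> N)"
    using bounded_contraction_depth_iff[OF assms] .
  \<comment> \<open>The second equivalence is the first one for the class of duals, whose circuits
    are the cocircuits of the original class.\<close>
  have "matroid M" if "M \<in> matroid_dual ` \<C>" for M
    using that assms matroid.matroid_dual by blast
  then have "(\<exists>k. \<forall>M \<in> matroid_dual ` \<C>. contraction_depth M \<le> k) \<longleftrightarrow>
      (\<exists>N. \<forall>M \<in> matroid_dual ` \<C>. \<forall>C. matroid_circuit M C \<longrightarrow> card C \<le> N)"
    by (rule bounded_contraction_depth_iff)
  then
  show "(\<exists>k. \<forall>M \<in> \<C>. deletion_depth M \<le> k) \<longleftrightarrow>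
      (\<exists>N. \<forall>M \<in> \<C>. \<forall>C. matroid_cocircuit M C \<longrightarrow> card C \<le> N)"
    using deletion_depth_eq_contraction_depth_dual[OF assms]
    by (simp add: matroid_cocircuit_def)
qed

end
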